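(* Let $G$ be a finite simple connected graph with $m$ edges and spectral radius $\rho(G) > \sqrt{m}$ (that is, $G$ is a Nosal graph). Then $$\mathrm{bk}(G) > \frac{1}{9}\sqrt{m}.$$
   Context: All graphs are finite, simple and connected, and have no isolated vertices. For a graph $G$, $\rho(G)$ denotes its spectral radius, i.e. the largest eigenvalue of its adjacency matrix. A graph $G$ with $m$ edges is called Nosal if $\rho(G)>\sqrt{m}$. For an integer $k\ge 1$, the book of size $k$, denoted $B_k$, is the graph formed by $k$ triangles sharing a common edge. The booksize $\mathrm{bk}(G)$ is the maximum integer $k$ for which $B_k$ is a (not necessarily induced) subgraph of $G$ (with $\mathrm{bk}(G)=0$ if $G$ is triangle-free); equivalently, it is the maximum, over edges of $G$, of the number of triangles containing that edge. *)

theory Defs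
  imports "HOL-Analysis.Analysis" "Jordan_Normal_Form.Spectral_Radius"
begin

definition simple_graph :: "'a set \<Rightarrow> 'a set set \<Rightarrow> bool" where
  "simple_graph V E \<longleftrightarrow> finite V \<and> E \<subseteq> {e. e \<subseteq> V \<and> card e = 2}"

text \<open>The null graph does not count as connected.\<close>

definition connected_graph :: "'a set \<Rightarrow> 'a set set \<Rightarrow> bool" where
  "connected_graph V E \<longleftrightarrow>
     V \<noteq> {} \<and> (\<forall>u\<in>V. \<forall>v\<in>V. (u, v) \<in> {(x, y). {x, y} \<in> E}\<^sup>*)"

definition no_isolated_vertices :: "'a set \<Rightarrow> 'a set set \<Rightarrow> bool" where
  "no_isolated_vertices V E \<longleftrightarrow> (\<forall>v\<in>V. \<exists>e\<in>E. v \<in> e)"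

text \<open>Matrices are indexed by natural numbers, so the vertices are listed in some order. The
  choice is immaterial for the spectrum: two enumerations give permutation-similar matrices.\<close>

definition vertex_enum :: "'a set \<Rightarrow> nat \<Rightarrow> 'a" where
  "vertex_enum V = (SOME h. bij_betw h {0..<card V} V)"

definition adjacency_matrix :: "'a set \<Rightarrow> 'a set set \<Rightarrow> real mat" where
  "adjacency_matrix V E =
     mat (card V) (card V) (\<lambda>(i, j). if {vertex_enum V i, vertex_enum V j} \<in> E then 1 else 0)"

text \<open>The adjacency matrix is real symmetric, so all its eigenvalues are real and the largest one
  is taken over the real spectrum. The library's \<open>spectral_radius\<close> (for complex
  matrices) is the largest modulus of an eigenvalue instead.\<close>

definition graph_spectral_radius :: "'a set \<Rightarrow> 'a set set \<Rightarrow> real" where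
  "graph_spectral_radius V E = Max (spectrum (adjacency_matrix V E))"

definition nosal :: "'a set \<Rightarrow> 'a set set \<Rightarrow> bool" where
  "nosal V E \<longleftrightarrow> graph_spectral_radius V E > sqrt (real (card E))"

text \<open>The common edge of the book is \<open>{0, 1}\<close>; its triangles are \<open>{0, 1, i}\<close> for
  \<open>2 \<le> i < k + 2\<close>.\<close>

definition book_vertices :: "nat \<Rightarrow> nat set" where
  "book_vertices k = {0..<k + 2}"

definition book_edges :: "nat \<Rightarrow> nat set set" where
  "book_edges k = insert {0, 1} (\<Union>i\<in>{2..<k + 2}. {{0, i}, {1, i}})"

definition contains_subgraph :: "'a set \<Rightarrow> 'a set set \<Rightarrow> 'b set \<Rightarrow> 'b set set \<Rightarrow> bool" where
  "contains_subgraph V E W F \<longleftrightarrow>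
     (\<exists>f. inj_on f W \<and> f ` W \<subseteq> V \<and> (\<forall>e\<in>F. f ` e \<in> E))"

definition booksize :: "'a set \<Rightarrow> 'a set set \<Rightarrow> nat" where
  "booksize V E =
     Max (insert 0 {k. k \<ge> 1 \<and> contains_subgraph V E (book_vertices k) (book_edges k)})"

text \<open>The sets whose maxima are taken above are finite, and the spectrum is nonempty.\<close>

lemma finite_book_sizes:
  assumes "finite V"
  shows "finite {k. k \<ge> 1 \<and> contains_subgraph V E (book_vertices k) (book_edges k)}"
proof (rule finite_subset)
  show "{k. k \<ge> 1 \<and> contains_subgraph V E (book_vertices k) (book_edges k)} \<subseteq> {..card V}"
  proof
    fix k assume "k \<in> {k. k \<ge> 1 \<and> contains_subgraph V E (book_vertices k) (book_edges k)}"
    then obtain f where "inj_on f (book_vertices k)" "f ` book_vertices k \<subseteq> V"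
      by (auto simp: contains_subgraph_def)
    then have "card (book_vertices k) \<le> card V"
      using assms card_inj_on_le by blast
    then show "k \<in> {..card V}" by (simp add: book_vertices_def)
  qed
qed simp

lemma finite_spectrum_adjacency_matrix: "finite (spectrum (adjacency_matrix V E))"
  by (rule card_finite_spectrum(1)[of _ "card V"]) (simp add: adjacency_matrix_def)

lemma spectrum_adjacency_matrix_nonempty:
  assumes "finite V" "V \<noteq> {}"
  shows "spectrum (adjacency_matrix V E) \<noteq> {}"
proof -
  define n where "n = card V"
  define A where "A = adjacency_matrix V E"
  define B where "B = map_mat complex_of_real A"
  have n: "n > 0" using assms by (simp add: n_def card_gt_0_iff)
  have A: "A \<in> carrier_mat n n" by (simp add: A_def adjacency_matrix_def n_def)
  then have B: "B \<in> carrier_mat n n" by (simp add: B_def)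
  have sym: "A $$ (i, j) = A $$ (j, i)" if "i < n" "j < n" for i j
    using that by (simp add: A_def adjacency_matrix_def n_def insert_commute)
  obtain z where z: "eigenvalue B z"
    using spectrum_non_empty[OF B n] by (auto simp: spectrum_def)
  then obtain v where v: "v \<in> carrier_vec n" "v \<noteq> 0\<^sub>v n" "B *\<^sub>v v = z \<cdot>\<^sub>v v"
    using B by (auto simp: eigenvalue_def eigenvector_def)
  have row: "(\<Sum>j<n. of_real (A $$ (i, j)) * v $ j) = z * v $ i" if "i < n" for i
  proof -
    have "(B *\<^sub>v v) $ i = z * v $ i" using v that by simp
    then show ?thesis
      using that A B v(1) by (simp add: scalar_prod_def B_def lessThan_atLeast0)
  qed
  define q where "q = (\<Sum>i<n. \<Sum>j<n. cnj (v $ i) * of_real (A $$ (i, j)) * v $ j)"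
  define r where "r = (\<Sum>i<n. (cmod (v $ i))\<^sup>2)"
  have "cnj q = (\<Sum>i<n. \<Sum>j<n. cnj (v $ j) * of_real (A $$ (j, i)) * v $ i)"
    by (auto simp: q_def mult_ac sym intro!: sum.cong)
  also have "\<dots> = q" unfolding q_def by (rule sum.swap)
  finally have "q \<in> \<real>" by (simp add: Reals_cnj_iff)
  moreover have "q = (\<Sum>i<n. cnj (v $ i) * (z * v $ i))"
    unfolding q_def by (intro sum.cong refl) (simp add: row[symmetric] sum_distrib_left mult.assoc)
  then have "q = z * of_real r"
    unfolding r_def of_real_sum sum_distrib_left
    by (simp add: complex_norm_square mult_ac del: of_real_power)
  moreover have "r > 0"
  proof -
    obtain i where "i < n" "v $ i \<noteq> 0"
      using v(1,2) by (metis carrier_vecD eq_vecI index_zero_vec(1) index_zero_vec(2))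
    then show ?thesis unfolding r_def by (intro sum_pos2[of _ i]) auto
  qed
  ultimately have "z \<in> \<real>"
    by (metis Reals_divide Reals_of_real less_irrefl nonzero_mult_div_cancel_right of_real_eq_0_iff)
  then obtain x where x: "z = of_real x" by (auto elim: Reals_cases)
  have "poly (char_poly B) z = 0" using z eigenvalue_root_char_poly[OF B] by simp
  then have "poly (char_poly A) x = 0"
    by (simp add: B_def x of_real_hom.char_poly_hom[OF A] of_real_hom.poly_map_poly)
  then show ?thesis
    using eigenvalue_root_char_poly[OF A] by (auto simp: spectrum_def A_def)
qed

end

theory Submission
  imports Defs
begin

text \<open>Suppose that the ends of every edge have at most \<open>k \<le> \<surd>m / 6\<close> common neighbours, let \<open>x\<close> be a
  nonnegative eigenvector for the largest eigenvalue \<open>\<rho>\<close>, scaled so that its largest entry is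
  \<open>x\<^sub>u = 1\<close>, and let \<open>N\<close> be the neighbourhood of \<open>u\<close> and \<open>T\<close> its complement. Expanding
  \<open>\<rho>\<^sup>2 = \<rho>\<^sup>2 x\<^sub>u\<close> and bounding the number of neighbours in \<open>N\<close> of each \<open>z \<in> T\<close> below by the
  sum of their entries yields
  \<open>\<rho>\<^sup>2 - m \<le> \<Sum> (x\<^sub>i + x\<^sub>j - 1) - L\<close>, the sum being over the edges inside \<open>N\<close> or inside \<open>T\<close>, where
  \<open>L\<close> is the sum of \<open>x\<^sub>w x\<^sub>z\<close> over the nonadjacent pairs in \<open>N \<times> T\<close>. Because
  \<open>x\<^sub>i + x\<^sub>j - 1 \<le> x\<^sub>i x\<^sub>j\<close>, the edges inside \<open>T\<close> contribute at most \<open>L / 2\<close>. An edge \<open>wv\<close> inside \<open>N\<close>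
  contributes only if its heavier end, say \<open>v\<close>, has \<open>x\<^sub>v > 1 / 2\<close>; then the neighbours of \<open>v\<close>, nearly all
  of which lie in \<open>T\<close> and are not adjacent to \<open>w\<close>, pay for the contribution out of the other
  half of \<open>L\<close>. Hence \<open>\<rho>\<^sup>2 \<le> m\<close>.\<close>

section \<open>The weighted edge inequality under bounded codegrees\<close>

text \<open>Each edge inside \<open>N\<close> is charged to its lighter end \<open>w\<close>, and
  the entries at the non-neighbours of \<open>w\<close> in \<open>T\<close> pay for all charges at
  \<open>w\<close>: at most \<open>k\<close> edges inside \<open>N\<close> meet \<open>w\<close>,
  while a heavy neighbour of \<open>w\<close> forces much weight into \<open>T\<close>, little of it
  adjacent to \<open>w\<close>.\<close>

lemma charge_to_smaller_endpoint:
  fixes a :: "'a \<Rightarrow> 'a \<Rightarrow> real" and x :: "'a \<Rightarrow> real"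
  assumes fin: "finite V" and sym: "\<And>i j. a i j = a j i" and a01: "\<And>i j. a i j \<in> {0, 1}"
    and x0: "\<And>i. 0 \<le> x i" and x1: "\<And>i. i \<in> V \<Longrightarrow> x i \<le> 1"
    and eig: "\<And>i. i \<in> V \<Longrightarrow> (\<Sum>j\<in>V. a i j * x j) = \<rho> * x i"
    and codeg: "\<And>i j. i \<in> V \<Longrightarrow> j \<in> V \<Longrightarrow> a i j = 1 \<Longrightarrow> (\<Sum>l\<in>V. a i l * a j l) \<le> k"
    and k: "0 \<le> k" "6 * k \<le> \<rho>"
    and u: "u \<in> V" and N: "N = {w \<in> V. a u w = 1}" and T: "T = V - N"
  shows "(\<Sum>w\<in>N. \<Sum>v\<in>N. a w v * (x w + x v - 1)) \<le> (\<Sum>w\<in>N. x w * (\<Sum>z\<in>T. (1 - a w z) * x z))"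
proof -
  have VNT: "V = N \<union> T" "N \<inter> T = {}" and finNT: "finite N" "finite T"
    using fin by (auto simp: N T)
  have a0: "0 \<le> a i j" "a i j \<le> 1" for i j using a01[of i j] by auto
  have degN: "(\<Sum>v\<in>N. a w v) \<le> k" if w: "w \<in> N" for w
  proof -
    have "(\<Sum>v\<in>N. a w v) = (\<Sum>v\<in>N. a u v * a w v)"
      by (intro sum.cong) (auto simp: N)
    also have "\<dots> \<le> (\<Sum>v\<in>V. a u v * a w v)"
      using VNT fin by (intro sum_mono2) (auto simp: a0)
    also have "\<dots> \<le> k" using codeg[OF u, of w] w by (auto simp: N)
    finally show ?thesis .
  qed
  \<comment> \<open>The charge is the positive part of the contribution, so that it can be bounded
    end by end; on ties both orientations carry it, which is harmless for an upper bound. The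
    left-hand sum meets every edge in both orientations, whence the factor 2 in
    \<open>g_sum\<close>.\<close>
  define g where "g w v = (if x w \<le> x v then a w v * max 0 (x w + x v - 1) else 0)" for w v
  have g_sum: "2 * (\<Sum>v\<in>N. g w v) \<le> x w * (\<Sum>z\<in>T. (1 - a w z) * x z)" if w: "w \<in> N" for w
  proof -
    define P where "P = {v \<in> N. a w v = 1 \<and> x w \<le> x v \<and> x w + x v > 1}"
    have finP: "finite P" using finNT by (simp add: P_def)
    have g0: "g w v = 0" if "v \<in> N" "v \<notin> P" for v
      using that a01[of w v] by (auto simp: g_def P_def max_def)
    show ?thesis
    proof (cases "P = {}")
      case True
      then have "(\<Sum>v\<in>N. g w v) = 0" using g0 by simp
      moreover have "0 \<le> x w * (\<Sum>z\<in>T. (1 - a w z) * x z)"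
        using a0 x0 by (intro mult_nonneg_nonneg sum_nonneg) auto
      ultimately show ?thesis by simp
    next
      case False
      \<comment> \<open>The heaviest charged neighbour serves twice: its entry bounds every single
        charge, and its neighbourhood supplies the payment.\<close>
      obtain v where v: "v \<in> P" "\<And>v'. v' \<in> P \<Longrightarrow> x v' \<le> x v"
        using Max_in[of "x ` P"] finP False by (metis (no_types, lifting) Max_ge finite_imageI imageE image_eqI image_is_empty)
      have vN: "v \<in> N" "a w v = 1" "x v > 1 / 2" using v(1) by (auto simp: P_def)
      have wV: "w \<in> V" and vV: "v \<in> V" using w vN VNT by auto
      have "g w v' \<le> a w v' * (x w * x v)" if v': "v' \<in> N" for v'
      proof (cases "v' \<in> P")
        case True
        then have "0 \<le> (1 - x w) * (1 - x v')"
          using x1 wV VNT by (intro mult_nonneg_nonneg) (auto simp: P_def)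
        then have "x w + x v' - 1 \<le> x w * x v'" by (simp add: algebra_simps)
        also have "\<dots> \<le> x w * x v" using v(2)[OF True] x0 by (intro mult_left_mono) auto
        finally show ?thesis using True by (auto simp: g_def P_def)
      next
        case False
        then show ?thesis using g0[OF v'] x0 a0 by auto
      qed
      then have "(\<Sum>v\<in>N. g w v) \<le> (\<Sum>v'\<in>N. a w v') * (x w * x v)"
        unfolding sum_distrib_right by (intro sum_mono)
      also have "\<dots> \<le> k * (x w * x v)"
        using degN[OF w] x0 by (intro mult_right_mono) auto
      finally have gain: "(\<Sum>v\<in>N. g w v) \<le> x w * (k * x v)" by (simp add: mult_ac)
      have "(\<Sum>z\<in>T. a w z * a v z) \<le> (\<Sum>z\<in>V. a w z * a v z)"
        using VNT fin by (intro sum_mono2) (auto simp: a0)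
      also have "\<dots> \<le> k" using codeg[OF wV vV vN(2)] .
      finally have common: "(\<Sum>z\<in>T. a w z * a v z) \<le> k" .
      have "(\<Sum>z\<in>N. a v z * x z) \<le> (\<Sum>z\<in>N. a v z)"
        using x1 VNT a0 by (intro sum_mono) (auto intro: mult_left_le)
      then have inner: "(\<Sum>z\<in>N. a v z * x z) \<le> k" using degN[OF vN(1)] by simp
      \<comment> \<open>The neighbours of \<open>v\<close> weigh \<open>\<rho> * x v\<close>.
        Discarding those in \<open>N\<close> and those shared with \<open>w\<close> costs at most
        \<open>k\<close> each; the rest are non-neighbours of \<open>w\<close> in
        \<open>T\<close>.\<close>
      have "\<rho> * x v = (\<Sum>z\<in>N. a v z * x z) + (\<Sum>z\<in>T. a v z * x z)"
        using eig[OF vV] VNT finNT by (simp add: sum.union_disjoint)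
      then have "\<rho> * x v - k \<le> (\<Sum>z\<in>T. a v z * x z)" using inner by simp
      also have "\<dots> \<le> (\<Sum>z\<in>T. a w z * a v z + (1 - a w z) * x z)"
      proof (intro sum_mono)
        fix z assume "z \<in> T"
        then show "a v z * x z \<le> a w z * a v z + (1 - a w z) * x z"
          using a01[of v z] a01[of w z] x0[of z] x1[of z] VNT by auto
      qed
      finally have loss: "\<rho> * x v - 2 * k \<le> (\<Sum>z\<in>T. (1 - a w z) * x z)"
        using common by (simp add: sum.distrib)
      \<comment> \<open>As \<open>x v > 1 / 2\<close>, the discarded \<open>2 * k\<close> is at most
        \<open>4 * k * x v\<close>; the doubled gain needs another \<open>2 * k * x v\<close>. This
        is the origin of the constant 6.\<close>
      have "6 * k * x v \<le> \<rho> * x v" using k x0 by (intro mult_right_mono) auto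
      moreover have "k \<le> k * (2 * x v)" using k vN(3) mult_left_mono[of 1 "2 * x v" k] by simp
      ultimately have "2 * (k * x v) \<le> (\<Sum>z\<in>T. (1 - a w z) * x z)" using loss by simp
      then have "x w * (2 * (k * x v)) \<le> x w * (\<Sum>z\<in>T. (1 - a w z) * x z)"
        using x0 by (intro mult_left_mono) auto
      then show ?thesis using gain by simp
    qed
  qed
  have "(\<Sum>w\<in>N. \<Sum>v\<in>N. a w v * (x w + x v - 1)) \<le> (\<Sum>w\<in>N. \<Sum>v\<in>N. g w v + g v w)"
  proof (intro sum_mono)
    fix w v
    show "a w v * (x w + x v - 1) \<le> g w v + g v w"
      using a01[of w v] sym[of w v] by (auto simp: g_def max_def)
  qed
  also have "\<dots> = 2 * (\<Sum>w\<in>N. \<Sum>v\<in>N. g w v)"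
    using sum.swap[of "\<lambda>w v. g v w" N N] by (simp add: sum.distrib)
  also have "\<dots> \<le> (\<Sum>w\<in>N. x w * (\<Sum>z\<in>T. (1 - a w z) * x z))"
    by (subst sum_distrib_left) (intro sum_mono g_sum)
  finally show ?thesis .
qed

text \<open>For an adjacency indicator the right-hand side counts every edge twice, so the bound
  reads \<open>\<rho>\<^sup>2 \<le> m\<close>. The sums over edges inside \<open>N\<close> and
  inside \<open>T\<close> also run over ordered pairs, so each may use up one full
  \<open>L\<close>.\<close>

lemma eigenvalue_square_le:
  fixes a :: "'a \<Rightarrow> 'a \<Rightarrow> real" and x :: "'a \<Rightarrow> real"
  assumes fin: "finite V" and sym: "\<And>i j. a i j = a j i" and a01: "\<And>i j. a i j \<in> {0, 1}"
    and x0: "\<And>i. 0 \<le> x i" and x1: "\<And>i. i \<in> V \<Longrightarrow> x i \<le> 1"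
    and eig: "\<And>i. i \<in> V \<Longrightarrow> (\<Sum>j\<in>V. a i j * x j) = \<rho> * x i"
    and codeg: "\<And>i j. i \<in> V \<Longrightarrow> j \<in> V \<Longrightarrow> a i j = 1 \<Longrightarrow> (\<Sum>l\<in>V. a i l * a j l) \<le> k"
    and k: "0 \<le> k" "6 * k \<le> \<rho>"
    and u: "u \<in> V" "x u = 1"
  shows "2 * \<rho>\<^sup>2 \<le> (\<Sum>i\<in>V. \<Sum>j\<in>V. a i j)"
proof -
  define N where "N = {w \<in> V. a u w = 1}"
  define T where "T = V - N"
  have VNT: "V = N \<union> T" "N \<inter> T = {}" and finNT: "finite N" "finite T"
    using fin by (auto simp: N_def T_def)
  have a0: "0 \<le> a i j" "a i j \<le> 1" for i j using a01[of i j] by auto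
  have split: "sum f V = sum f N + sum f T" for f :: "'a \<Rightarrow> real"
    using VNT finNT by (simp add: sum.union_disjoint)
  define p where "p z = (\<Sum>w\<in>N. a z w * x w)" for z
  define b where "b z = (\<Sum>w\<in>T. a z w * x w)" for z
  define c where "c z = (\<Sum>w\<in>N. a z w)" for z
  define L where "L = (\<Sum>z\<in>T. x z * (\<Sum>w\<in>N. (1 - a z w) * x w))"
  have pb: "p z + b z = \<rho> * x z" if "z \<in> V" for z
    using eig[OF that] by (simp add: split p_def b_def)
  \<comment> \<open>The eigenvalue equation at \<open>u\<close> involves only \<open>N\<close>, so
    \<open>N\<close> has total weight \<open>\<rho>\<close> and the non-neighbours of
    \<open>z\<close> in \<open>N\<close> weigh \<open>\<rho> - p z\<close>.\<close>
  have "(\<Sum>w\<in>N. x w) = p u" by (auto simp: p_def N_def intro!: sum.cong)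
  moreover have "b u = 0"
    unfolding b_def using a01[of u] by (intro sum.neutral) (force simp: T_def N_def)
  ultimately have xN: "(\<Sum>w\<in>N. x w) = \<rho>" using pb[OF u(1)] u(2) by simp
  have ap: "(\<Sum>w\<in>N. (1 - a z w) * x w) = \<rho> - p z" for z
    by (simp add: p_def algebra_simps sum_subtractf xN)

  have swap: "(\<Sum>w\<in>S. \<Sum>v\<in>S. a w v * x w) = (\<Sum>w\<in>S. \<Sum>v\<in>S. a w v * x v)" for S
    by (subst sum.swap, intro sum.cong refl, subst sym, rule refl)
  \<comment> \<open>The eigenvalue equation is applied a second time, at each member of
    \<open>N\<close>; the edges between \<open>N\<close> and \<open>T\<close> are then regrouped by
    their end in \<open>T\<close>.\<close>
  have "\<rho>\<^sup>2 = (\<Sum>w\<in>N. \<rho> * x w)" by (simp add: sum_distrib_left[symmetric] xN power2_eq_square)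
  also have "\<dots> = (\<Sum>w\<in>N. p w) + (\<Sum>w\<in>N. b w)"
    using VNT by (simp add: pb[symmetric] sum.distrib)
  also have "(\<Sum>w\<in>N. b w) = (\<Sum>z\<in>T. c z * x z)"
    unfolding b_def c_def sum_distrib_right by (subst sum.swap) (simp add: sym)
  finally have rho2: "\<rho>\<^sup>2 = (\<Sum>w\<in>N. p w) + (\<Sum>z\<in>T. c z * x z)" .
  have internal: "(\<Sum>w\<in>S. \<Sum>v\<in>S. a w v * (x w + x v - 1)) =
      2 * (\<Sum>w\<in>S. \<Sum>v\<in>S. a w v * x v) - (\<Sum>w\<in>S. \<Sum>v\<in>S. a w v)" for S
    by (simp add: ring_distribs sum.distrib sum_subtractf swap)
  have edges: "(\<Sum>i\<in>V. \<Sum>j\<in>V. a i j) =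
      (\<Sum>w\<in>N. \<Sum>v\<in>N. a w v) + 2 * (\<Sum>z\<in>T. c z) + (\<Sum>w\<in>T. \<Sum>v\<in>T. a w v)"
  proof -
    have "(\<Sum>w\<in>N. \<Sum>z\<in>T. a w z) = (\<Sum>z\<in>T. c z)"
      unfolding c_def by (subst sum.swap) (simp add: sym)
    then show ?thesis by (simp add: split sum.distrib c_def)
  qed
  have TT: "(\<Sum>w\<in>T. \<Sum>v\<in>T. a w v * (x w + x v - 1)) = 2 * (\<Sum>z\<in>T. b z) - (\<Sum>w\<in>T. \<Sum>v\<in>T. a w v)"
    by (simp add: internal b_def)
  have NN: "(\<Sum>w\<in>N. \<Sum>v\<in>N. a w v * (x w + x v - 1)) = 2 * (\<Sum>z\<in>N. p z) - (\<Sum>w\<in>N. \<Sum>v\<in>N. a w v)"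
    by (simp add: internal p_def)

  \<comment> \<open>Replacing the weight \<open>p z\<close> by the count \<open>c z\<close> is what
    lets the number of edges between \<open>N\<close> and \<open>T\<close> enter.\<close>
  have "L - (\<Sum>z\<in>T. b z) = (\<Sum>z\<in>T. p z * (1 - x z))"
    unfolding L_def ap sum_subtractf[symmetric]
  proof (intro sum.cong refl)
    fix z assume "z \<in> T"
    then have "b z = \<rho> * x z - p z" using pb[of z] VNT by simp
    then show "x z * (\<rho> - p z) - b z = p z * (1 - x z)" by (simp add: algebra_simps)
  qed
  also have "\<dots> \<le> (\<Sum>z\<in>T. c z * (1 - x z))"
  proof (intro sum_mono mult_right_mono)
    fix z assume "z \<in> T"
    then show "0 \<le> 1 - x z" using x1[of z] VNT by simp
    show "p z \<le> c z" unfolding p_def c_def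
      using x1 VNT a0 by (intro sum_mono) (auto intro: mult_left_le)
  qed
  finally have cross: "L - (\<Sum>z\<in>T. b z) \<le> (\<Sum>z\<in>T. c z) - (\<Sum>z\<in>T. c z * x z)"
    by (simp add: algebra_simps sum_subtractf)

  have "(\<Sum>w\<in>T. \<Sum>v\<in>T. a w v * (x w + x v - 1)) \<le> (\<Sum>w\<in>T. \<Sum>v\<in>T. a w v * (x w * x v))"
  proof (intro sum_mono mult_left_mono a0)
    fix w v assume "w \<in> T" "v \<in> T"
    then have "0 \<le> (1 - x w) * (1 - x v)"
      using x1 VNT by (intro mult_nonneg_nonneg) auto
    then show "x w + x v - 1 \<le> x w * x v" by (simp add: algebra_simps)
  qed
  also have "\<dots> = (\<Sum>z\<in>T. x z * b z)"
    by (simp add: b_def sum_distrib_left mult_ac)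
  also have "\<dots> \<le> L" unfolding L_def ap
  proof (intro sum_mono mult_left_mono x0)
    fix z assume "z \<in> T"
    then have "z \<in> V" using VNT by simp
    moreover have "\<rho> * x z \<le> \<rho>" using x1[OF \<open>z \<in> V\<close>] k by (intro mult_left_le) auto
    ultimately show "b z \<le> \<rho> - p z" using pb[of z] by simp
  qed
  finally have Tside: "(\<Sum>w\<in>T. \<Sum>v\<in>T. a w v * (x w + x v - 1)) \<le> L" .

  have "(\<Sum>w\<in>N. \<Sum>v\<in>N. a w v * (x w + x v - 1)) \<le> (\<Sum>w\<in>N. x w * (\<Sum>z\<in>T. (1 - a w z) * x z))"
    by (rule charge_to_smaller_endpoint[OF fin sym a01 x0 x1 eig codeg k u(1) N_def T_def])
  also have "\<dots> = L"
    unfolding L_def sum_distrib_left by (subst sum.swap) (simp add: sym mult_ac)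
  finally have "(\<Sum>w\<in>N. \<Sum>v\<in>N. a w v * (x w + x v - 1)) \<le> L" .
  \<comment> \<open>Twice \<open>cross\<close> supplies \<open>- 2 * L\<close>, which absorbs one
    \<open>L\<close> from the edges inside \<open>N\<close> and one from those inside
    \<open>T\<close>.\<close>
  with Tside NN TT cross edges rho2 show ?thesis by linarith
qed

section \<open>A nonnegative eigenvector from the Rayleigh quotient\<close>

text \<open>The quadratic form attains its maximum on the unit sphere, and since \<open>a\<close> is
  nonnegative, taking absolute values of the entries preserves the maximum. A maximiser is an
  eigenvector. Applied to an eigenvector \<open>y\<close>, the last clause makes \<open>M\<close> at
  least the eigenvalue of \<open>y\<close>.\<close>

lemma nonneg_eigenvector_dominating_Rayleigh_quotient:
  fixes a :: "'a \<Rightarrow> 'a \<Rightarrow> real" and y :: "'a \<Rightarrow> real"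
  assumes fin: "finite V" and sym: "\<And>i j. a i j = a j i" and nonneg: "\<And>i j. 0 \<le> a i j"
    and y: "\<exists>i\<in>V. y i \<noteq> 0"
  obtains x M where "\<And>i. 0 \<le> x i" "\<exists>i\<in>V. 0 < x i"
    "\<And>i. i \<in> V \<Longrightarrow> (\<Sum>j\<in>V. a i j * x j) = M * x i"
    "(\<Sum>i\<in>V. \<Sum>j\<in>V. a i j * y i * y j) \<le> M * (\<Sum>i\<in>V. (y i)\<^sup>2)"
proof -
  define q :: "('a \<Rightarrow> real) \<Rightarrow> real" where "q h = (\<Sum>i\<in>V. \<Sum>j\<in>V. a i j * h i * h j)" for h
  define s :: "('a \<Rightarrow> real) \<Rightarrow> real" where "s h = (\<Sum>i\<in>V. (h i)\<^sup>2)" for h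
  \<comment> \<open>Pinning the values off \<open>V\<close> to 0 makes \<open>B\<close> a product of
    compact sets, hence compact even when the type \<open>'a\<close> is infinite.\<close>
  define B where "B = PiE UNIV (\<lambda>i. if i \<in> V then {-1..1} else {0::real})"
  define K where "K = B \<inter> {h. s h = 1}"
  have s_nonneg: "0 \<le> s h" for h by (simp add: s_def sum_nonneg)
  have s_zero: "h i = 0" if "s h = 0" "i \<in> V" for h i
    using that fin by (simp add: s_def sum_nonneg_eq_0_iff)
  define nrm where "nrm h i = (if i \<in> V then h i / sqrt (s h) else 0)" for h i
  have s_nrm: "s (nrm h) = 1" and q_nrm: "q (nrm h) = q h / s h" if "s h > 0" for h
  proof -
    have "s (nrm h) = (\<Sum>i\<in>V. (h i)\<^sup>2 / s h)"
      unfolding s_def[of "nrm h"] using that by (intro sum.cong) (auto simp: nrm_def power_divide)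
    also have "\<dots> = 1" using that by (simp add: sum_divide_distrib[symmetric] s_def[of h, symmetric])
    finally show "s (nrm h) = 1" .
    have "q (nrm h) = (\<Sum>i\<in>V. \<Sum>j\<in>V. a i j * h i * h j / s h)"
      unfolding q_def using that by (intro sum.cong) (auto simp: nrm_def)
    then show "q (nrm h) = q h / s h" by (simp add: sum_divide_distrib[symmetric] q_def)
  qed
  have inK: "h \<in> K" if "s h = 1" "\<And>i. i \<notin> V \<Longrightarrow> h i = 0" for h
  proof -
    have "h i \<in> {-1..1}" if i: "i \<in> V" for i
    proof -
      have "(h i)\<^sup>2 \<le> s h" unfolding s_def using fin i by (intro member_le_sum) auto
      then show ?thesis using \<open>s h = 1\<close> by (simp add: abs_square_le_1 abs_le_iff)
    qed
    then show ?thesis using that by (auto simp: K_def B_def)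
  qed
  have "compactin (product_topology (\<lambda>i::'a. euclidean) UNIV) B"
    unfolding B_def compactin_PiE by auto
  then have "compact B" by (simp add: euclidean_product_topology)
  moreover have "closed {h. s h = 1}"
    unfolding s_def
    by (intro closed_Collect_eq continuous_intros) (simp_all add: continuous_on_product_coordinates)
  ultimately have "compact K" unfolding K_def by (rule compact_Int_closed)
  moreover have "s y > 0" using y s_zero[of y] s_nonneg[of y] by force
  then have "nrm y \<in> K" by (intro inK) (auto simp: s_nrm nrm_def)
  moreover have "continuous_on K q"
    unfolding q_def by (intro continuous_intros) (simp_all add: continuous_on_subset[OF continuous_on_product_coordinates])
  ultimately obtain v where v: "v \<in> K" "\<And>h. h \<in> K \<Longrightarrow> q h \<le> q v"
    using continuous_attains_sup[of K q] by blast
  define x where "x i = \<bar>v i\<bar>" for i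
  define M where "M = q v"
  have sx: "s x = 1" using v(1) by (simp add: x_def s_def K_def)
  have "q v \<le> q x" unfolding q_def
  proof (intro sum_mono)
    fix i j
    have "a i j * (v i * v j) \<le> a i j * \<bar>v i * v j\<bar>" by (intro mult_left_mono nonneg) auto
    then show "a i j * v i * v j \<le> a i j * x i * x j" by (simp add: x_def abs_mult mult.assoc)
  qed
  have bound: "q h \<le> M * s h" for h
  proof (cases "s h > 0")
    case True
    then have "nrm h \<in> K" by (intro inK) (auto simp: s_nrm nrm_def)
    then have "q h / s h \<le> M" using v(2)[of "nrm h"] q_nrm[OF True] by (simp add: M_def)
    then show ?thesis using True by (simp add: divide_le_eq)
  next
    case False
    then have "s h = 0" using s_nonneg[of h] by simp
    then have "q h = 0" using s_zero[of h] by (auto simp: q_def)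
    then show ?thesis using \<open>s h = 0\<close> by simp
  qed
  have qx: "q x = M" using bound[of x] \<open>q v \<le> q x\<close> sx by (simp add: M_def)
  \<comment> \<open>Moving the maximiser by \<open>t\<close> times its residual \<open>r\<close>
    changes the form minus \<open>M\<close> times the squared norm by \<open>2 * t * s r\<close> to
    first order, so \<open>r\<close> must vanish on \<open>V\<close>.\<close>
  define r where "r i = (\<Sum>j\<in>V. a i j * x j) - M * x i" for i
  have "s r = 0"
  proof (rule ccontr)
    assume "s r \<noteq> 0"
    then have "s r > 0" using s_nonneg[of r] by simp
    have expand: "q (\<lambda>i. x i + t * r i) - M * s (\<lambda>i. x i + t * r i) =
        2 * t * s r + t\<^sup>2 * (q r - M * s r)" for t
    proof -
      have q1: "q (\<lambda>i. x i + t * r i) = q x + 2 * t * (\<Sum>i\<in>V. r i * (\<Sum>j\<in>V. a i j * x j)) + t\<^sup>2 * q r"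
      proof -
        have "q (\<lambda>i. x i + t * r i) = q x + t * (\<Sum>i\<in>V. \<Sum>j\<in>V. a i j * r i * x j)
            + t * (\<Sum>i\<in>V. \<Sum>j\<in>V. a i j * x i * r j) + t\<^sup>2 * q r"
          unfolding q_def by (simp add: algebra_simps sum.distrib sum_distrib_left power2_eq_square)
        moreover have "(\<Sum>i\<in>V. \<Sum>j\<in>V. a i j * x i * r j) = (\<Sum>i\<in>V. \<Sum>j\<in>V. a i j * r i * x j)"
          by (subst sum.swap) (simp add: sym mult_ac)
        moreover have "(\<Sum>i\<in>V. r i * (\<Sum>j\<in>V. a i j * x j)) = (\<Sum>i\<in>V. \<Sum>j\<in>V. a i j * r i * x j)"
          by (simp add: sum_distrib_left mult_ac)
        ultimately show ?thesis by simp
      qed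
      have s1: "s (\<lambda>i. x i + t * r i) = s x + 2 * t * (\<Sum>i\<in>V. r i * x i) + t\<^sup>2 * s r"
        unfolding s_def by (simp add: algebra_simps sum.distrib sum_distrib_left power2_eq_square)
      have "s r = (\<Sum>i\<in>V. r i * (\<Sum>j\<in>V. a i j * x j) - M * (r i * x i))"
        unfolding s_def by (intro sum.cong) (simp_all add: r_def power2_eq_square algebra_simps)
      also have "\<dots> = (\<Sum>i\<in>V. r i * (\<Sum>j\<in>V. a i j * x j)) - M * (\<Sum>i\<in>V. r i * x i)"
        by (simp add: sum_subtractf sum_distrib_left)
      finally have "s r = (\<Sum>i\<in>V. r i * (\<Sum>j\<in>V. a i j * x j)) - M * (\<Sum>i\<in>V. r i * x i)" .
      then have "s r * (2 * t) = ((\<Sum>i\<in>V. r i * (\<Sum>j\<in>V. a i j * x j)) - M * (\<Sum>i\<in>V. r i * x i)) * (2 * t)"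
        by simp
      then show ?thesis unfolding q1 s1 using qx sx by (simp add: algebra_simps)
    qed
    \<comment> \<open>With this \<open>t\<close> the second-order term is at most
      \<open>t * s r\<close> in absolute value, half of the first-order gain; the summand 1 keeps
      \<open>D\<close> positive.\<close>
    define D where "D = \<bar>q r - M * s r\<bar> + 1"
    define t where "t = s r / D"
    have "D > 0" by (simp add: D_def)
    then have "t > 0" "t * D = s r" using \<open>s r > 0\<close> by (auto simp: t_def)
    have "2 * t * s r + t\<^sup>2 * (q r - M * s r) \<le> 0"
      using expand[of t] bound[of "\<lambda>i. x i + t * r i"] by simp
    then have "t * (2 * s r + t * (q r - M * s r)) \<le> 0"
      by (simp add: algebra_simps power2_eq_square)
    then have "2 * s r + t * (q r - M * s r) \<le> 0"
      using \<open>t > 0\<close> by (simp add: mult_le_0_iff)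
    moreover have "- D \<le> q r - M * s r" unfolding D_def by linarith
    then have "t * - D \<le> t * (q r - M * s r)"
      using \<open>t > 0\<close> by (intro mult_left_mono) auto
    ultimately show False using \<open>t * D = s r\<close> \<open>s r > 0\<close> by simp
  qed
  show thesis
  proof (rule that[of x M])
    show "0 \<le> x i" for i by (simp add: x_def)
    show "\<exists>i\<in>V. 0 < x i"
    proof (rule ccontr)
      assume "\<not> ?thesis"
      then have "s x = 0" by (auto simp: s_def x_def)
      then show False using sx by simp
    qed
    show "(\<Sum>j\<in>V. a i j * x j) = M * x i" if "i \<in> V" for i
      using s_zero[OF \<open>s r = 0\<close> that] by (simp add: r_def)
    show "(\<Sum>i\<in>V. \<Sum>j\<in>V. a i j * y i * y j) \<le> M * (\<Sum>i\<in>V. (y i)\<^sup>2)"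
      using bound[of y] by (simp add: q_def s_def)
  qed
qed

section \<open>Books, edge counts and the passage from matrices to vertices\<close>

text \<open>With the edge as spine, every common neighbour of its ends is the apex of one triangle
  of the book.\<close>

lemma contains_book:
  assumes "simple_graph V E" and "{i, j} \<in> E"
  shows "contains_subgraph V E (book_vertices (card {l \<in> V. {i, l} \<in> E \<and> {j, l} \<in> E}))
    (book_edges (card {l \<in> V. {i, l} \<in> E \<and> {j, l} \<in> E}))"
proof -
  define C where "C = {l \<in> V. {i, l} \<in> E \<and> {j, l} \<in> E}"
  have EV: "e \<subseteq> V" "card e = 2" if "e \<in> E" for e
    using assms(1) that by (auto simp: simple_graph_def)
  have ij: "i \<in> V" "j \<in> V" "i \<noteq> j" using EV[OF assms(2)] by (auto simp: card_insert_if)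
  have "finite C" using assms(1) by (simp add: C_def simple_graph_def)
  then obtain h where h: "bij_betw h {0..<card C} C"
    using ex_bij_betw_nat_finite by blast
  have hC: "h n \<in> C" if "n < card C" for n using h that by (auto simp: bij_betw_def)
  \<comment> \<open>Otherwise {i} or {j} would be an edge, but edges have two elements.\<close>
  have notC: "i \<notin> C" "j \<notin> C" using EV[of "{i}"] EV[of "{j}"] by (auto simp: C_def)
  define f where "f n = (if n = 0 then i else if n = 1 then j else h (n - 2))" for n :: nat
  have inj_h: "m = n" if "h m = h n" "m < card C" "n < card C" for m n
    using that h by (auto simp: bij_betw_def inj_on_def)
  have "inj_on f (book_vertices (card C))"
  proof (rule inj_onI)
    fix m n assume mn: "m \<in> book_vertices (card C)" "n \<in> book_vertices (card C)" "f m = f n"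
    have C: "h (l - 2) \<in> C" if "l \<in> book_vertices (card C)" "l \<noteq> 0" "l \<noteq> 1" for l
      using that hC[of "l - 2"] by (simp add: book_vertices_def)
    show "m = n"
    proof (cases "m \<in> {0, 1} \<or> n \<in> {0, 1}")
      case True
      then show ?thesis using mn(3) C[OF mn(1)] C[OF mn(2)] notC ij
        by (auto simp: f_def split: if_splits)
    next
      case False
      then have "h (m - 2) = h (n - 2)" using mn(3) by (simp add: f_def)
      then have "m - 2 = n - 2"
        using mn False by (intro inj_h) (auto simp: book_vertices_def)
      then show ?thesis using False by auto
    qed
  qed
  moreover have "f ` book_vertices (card C) \<subseteq> V"
    using ij hC by (auto simp: f_def book_vertices_def C_def)
  moreover have "f ` e \<in> E" if "e \<in> book_edges (card C)" for e
  proof -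
    consider "e = {0, 1}" | l where "2 \<le> l" "l < card C + 2" "e = {0, l} \<or> e = {1, l}"
      using \<open>e \<in> book_edges (card C)\<close> by (auto simp: book_edges_def)
    then show ?thesis
    proof cases
      case 1
      then show ?thesis using assms(2) by (simp add: f_def insert_commute)
    next
      case 2
      then have "h (l - 2) \<in> C" by (intro hC) auto
      then show ?thesis using 2 by (auto simp: f_def C_def insert_commute)
    qed
  qed
  ultimately show ?thesis unfolding contains_subgraph_def C_def by blast
qed

lemma codegree_le_booksize:
  assumes "simple_graph V E" and "{i, j} \<in> E"
  shows "card {l \<in> V. {i, l} \<in> E \<and> {j, l} \<in> E} \<le> booksize V E"
proof -
  have "finite {k. k \<ge> 1 \<and> contains_subgraph V E (book_vertices k) (book_edges k)}"
    using assms(1) by (intro finite_book_sizes) (simp add: simple_graph_def)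
  \<comment> \<open>An edge in no triangle is covered by the 0 inserted into the set of
    sizes.\<close>
  then show ?thesis
    unfolding booksize_def using contains_book[OF assms] by (intro Max_ge) auto
qed

text \<open>Writing the indicator as a sum over edges and swapping the sums leaves, for each edge,
  its two orientations, which differ because there are no loops.\<close>

lemma sum_adjacency_indicator:
  assumes "simple_graph V E"
  shows "(\<Sum>i\<in>V. \<Sum>j\<in>V. if {i, j} \<in> E then 1 else 0 :: real) = 2 * real (card E)"
proof -
  have fin: "finite V" and E: "\<And>e. e \<in> E \<Longrightarrow> e \<subseteq> V \<and> card e = 2"
    using assms by (auto simp: simple_graph_def)
  have finE: "finite E" using E fin by (intro finite_subset[of E "Pow V"]) auto
  have "(\<Sum>i\<in>V. \<Sum>j\<in>V. if {i, j} \<in> E then 1 else 0 :: real)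
      = (\<Sum>p\<in>V \<times> V. \<Sum>e\<in>E. if {fst p, snd p} = e then 1 else 0)"
    using fin finE by (simp add: sum.cartesian_product case_prod_beta)
  also have "\<dots> = (\<Sum>e\<in>E. \<Sum>p\<in>V \<times> V. if {fst p, snd p} = e then 1 else 0)"
    by (rule sum.swap)
  also have "\<dots> = (\<Sum>e\<in>E. 2)"
  proof (intro sum.cong refl)
    fix e assume "e \<in> E"
    then obtain s t where e: "e = {s, t}" "s \<noteq> t" "s \<in> V" "t \<in> V"
      using E[of e] by (auto simp: card_2_iff)
    have "(\<Sum>p\<in>V \<times> V. if {fst p, snd p} = e then 1 else 0 :: real)
        = real (card {p \<in> V \<times> V. {fst p, snd p} = e})"
      using fin by (simp add: sum.If_cases Int_def)
    also have "{p \<in> V \<times> V. {fst p, snd p} = e} = {(s, t), (t, s)}"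
      using e by (auto simp: doubleton_eq_iff)
    also have "real (card {(s, t), (t, s)}) = 2" using e by simp
    finally show "(\<Sum>p\<in>V \<times> V. if {fst p, snd p} = e then 1 else 0 :: real) = 2" .
  qed
  finally show ?thesis by simp
qed

text \<open>Inverting the vertex enumeration carries an eigenvector from matrix indices to vertices,
  so that the main argument can work with sums over \<open>V\<close>.\<close>

lemma graph_spectral_radius_eigenvector:
  assumes "finite V" "V \<noteq> {}"
  obtains y where "\<exists>i\<in>V. y i \<noteq> 0"
    "\<And>i. i \<in> V \<Longrightarrow> (\<Sum>j\<in>V. (if {i, j} \<in> E then 1 else 0) * y j) = graph_spectral_radius V E * y i"
proof -
  define A where "A = adjacency_matrix V E"
  define n where "n = card V"
  define h where "h = vertex_enum V"
  have A: "A \<in> carrier_mat n n" by (simp add: A_def adjacency_matrix_def n_def)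
  have h: "bij_betw h {0..<n} V"
    unfolding h_def n_def vertex_enum_def
    by (rule someI_ex[OF ex_bij_betw_nat_finite[OF assms(1)]])
  have "graph_spectral_radius V E \<in> spectrum A"
    unfolding graph_spectral_radius_def A_def
    by (intro Max_in finite_spectrum_adjacency_matrix spectrum_adjacency_matrix_nonempty assms)
  then obtain v where v: "v \<in> carrier_vec n" "v \<noteq> 0\<^sub>v n" "A *\<^sub>v v = graph_spectral_radius V E \<cdot>\<^sub>v v"
    using A by (auto simp: spectrum_def eigenvalue_def eigenvector_def)
  define g where "g = the_inv_into {0..<n} h"
  have gh: "g (h i) = i" if "i < n" for i
    using h that unfolding g_def by (intro the_inv_into_f_f) (auto simp: bij_betw_def)
  show thesis
  proof (rule that[of "\<lambda>w. v $ g w"])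
    obtain i where "i < n" "v $ i \<noteq> 0"
      using v(1,2) by (metis carrier_vecD eq_vecI index_zero_vec(1) index_zero_vec(2))
    then show "\<exists>w\<in>V. v $ g w \<noteq> 0"
      using h gh by (intro bexI[of _ "h i"]) (auto simp: bij_betw_def)
    fix w assume "w \<in> V"
    then obtain i where i: "i < n" "w = h i" using h by (auto simp: bij_betw_def)
    have "(\<Sum>j\<in>V. (if {w, j} \<in> E then 1 else 0) * v $ g j)
        = (\<Sum>j\<in>{0..<n}. (if {w, h j} \<in> E then 1 else 0) * v $ g (h j))"
      by (rule sum.reindex_bij_betw[OF h, symmetric])
    also have "\<dots> = (\<Sum>j\<in>{0..<n}. A $$ (i, j) * v $ j)"
      using i gh by (intro sum.cong) (auto simp: A_def adjacency_matrix_def n_def h_def)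
    also have "\<dots> = (A *\<^sub>v v) $ i" using A v(1) i by (simp add: scalar_prod_def)
    also have "\<dots> = graph_spectral_radius V E * v $ g w" using v i gh by simp
    finally show "(\<Sum>j\<in>V. (if {w, j} \<in> E then 1 else 0) * v $ g j) = graph_spectral_radius V E * v $ g w" .
  qed
qed

section \<open>Combining the spectral and the combinatorial bounds\<close>

theorem corollary1p1:
  fixes V :: "'a set" and E :: "'a set set"
  assumes "simple_graph V E"
    and "connected_graph V E"
    and "no_isolated_vertices V E"
    and "nosal V E"
  shows "real (booksize V E) > 1 / 9 * sqrt (real (card E))"
proof (rule ccontr)
  assume "\<not> ?thesis"
  then have small: "9 * real (booksize V E) \<le> sqrt (real (card E))" by simp
  have fin: "finite V" and ne: "V \<noteq> {}"
    using assms(1,2) by (auto simp: simple_graph_def connected_graph_def)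
  define a :: "'a \<Rightarrow> 'a \<Rightarrow> real" where "a i j = (if {i, j} \<in> E then 1 else 0)" for i j
  define R where "R = graph_spectral_radius V E"
  have sym: "a i j = a j i" and a01: "a i j \<in> {0, 1}" and a0: "0 \<le> a i j" for i j
    by (auto simp: a_def insert_commute)
  obtain y where y: "\<exists>i\<in>V. y i \<noteq> 0" "\<And>i. i \<in> V \<Longrightarrow> (\<Sum>j\<in>V. a i j * y j) = R * y i"
  proof (rule graph_spectral_radius_eigenvector[OF fin ne, of E])
    fix y assume "\<exists>i\<in>V. y i \<noteq> 0" "\<And>i. i \<in> V \<Longrightarrow>
      (\<Sum>j\<in>V. (if {i, j} \<in> E then 1 else 0) * y j) = graph_spectral_radius V E * y i"
    then show thesis by (intro that[of y]) (simp_all only: a_def R_def)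
  qed
  obtain x M where x: "\<And>i. 0 \<le> x i" "\<exists>i\<in>V. 0 < x i"
    "\<And>i. i \<in> V \<Longrightarrow> (\<Sum>j\<in>V. a i j * x j) = M * x i"
    and M: "(\<Sum>i\<in>V. \<Sum>j\<in>V. a i j * y i * y j) \<le> M * (\<Sum>i\<in>V. (y i)\<^sup>2)"
    using nonneg_eigenvector_dominating_Rayleigh_quotient[of V a y, OF fin sym a0 y(1)] by blast
  \<comment> \<open>The Rayleigh quotient of \<open>y\<close> is \<open>R\<close>, so
    \<open>R \<le> M\<close> and \<open>M\<close> inherits the Nosal inequality.\<close>
  have "(\<Sum>i\<in>V. \<Sum>j\<in>V. a i j * y i * y j) = (\<Sum>i\<in>V. y i * (\<Sum>j\<in>V. a i j * y j))"
    by (simp add: sum_distrib_left mult_ac)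
  also have "\<dots> = R * (\<Sum>i\<in>V. (y i)\<^sup>2)"
    unfolding sum_distrib_left[of R] by (intro sum.cong) (simp_all add: y(2) power2_eq_square)
  finally have "R * (\<Sum>i\<in>V. (y i)\<^sup>2) \<le> M * (\<Sum>i\<in>V. (y i)\<^sup>2)" using M by simp
  moreover have "0 < (\<Sum>i\<in>V. (y i)\<^sup>2)"
    using y(1) fin by (auto intro: sum_pos2)
  ultimately have "R \<le> M" by simp
  then have Mm: "sqrt (real (card E)) < M" using assms(4) by (simp add: nosal_def R_def)
  obtain u where u: "u \<in> V" "\<And>i. i \<in> V \<Longrightarrow> x i \<le> x u"
    using Max_in[of "x ` V"] fin ne
    by (metis (no_types, lifting) Max_ge finite_imageI imageE image_eqI image_is_empty)
  have xu: "0 < x u" using x(2) u(2) by fastforce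
  have codeg: "(\<Sum>l\<in>V. a i l * a j l) \<le> real (booksize V E)" if "a i j = 1" for i j
  proof -
    have "{i, j} \<in> E" using that by (auto simp: a_def split: if_splits)
    moreover have "(\<Sum>l\<in>V. a i l * a j l) = (\<Sum>l\<in>V. if {i, l} \<in> E \<and> {j, l} \<in> E then 1 else 0)"
      by (intro sum.cong) (auto simp: a_def)
    moreover have "\<dots> = real (card {l \<in> V. {i, l} \<in> E \<and> {j, l} \<in> E})"
      using fin by (simp add: sum.If_cases Int_def)
    ultimately show ?thesis using codegree_le_booksize[OF assms(1)] by simp
  qed
  \<comment> \<open>Division by the largest entry normalises the eigenvector. The codegree condition
    holds because six booksizes are at most nine, hence at most the square root of the edge count,
    which lies below \<open>M\<close>.\<close>
  have "2 * M\<^sup>2 \<le> (\<Sum>i\<in>V. \<Sum>j\<in>V. a i j)"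
  proof (rule eigenvalue_square_le[where x = "\<lambda>i. x i / x u" and u = u and k = "real (booksize V E)"])
    show "(\<Sum>j\<in>V. a i j * (x j / x u)) = M * (x i / x u)" if "i \<in> V" for i
      using x(3)[OF that] by (simp add: sum_divide_distrib[symmetric])
    show "6 * real (booksize V E) \<le> M" using small Mm by simp
  qed (use fin sym a01 x(1) u xu codeg in auto)
  then have "M\<^sup>2 \<le> real (card E)"
    using sum_adjacency_indicator[OF assms(1)] by (simp add: a_def)
  then show False using Mm real_le_rsqrt by fastforce
qed

end
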